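(* Let $q>0$ and let $f\colon X\to Y$ be a $q$-quasi-isometry of the metric spaces $(X,d_X)$ and $(Y,d_Y)$. Then $f$ induces a bijection $f\colon\mathcal U_X/{\sim}\to\mathcal U_Y/{\sim}$ (mapping the class of $R$ to the class of $f(R)$) which is bi-Lipschitz continuous: \[ q^{-1}t_X(\zeta,\xi)\le t_Y(f(\zeta),f(\xi))\le q\,t_X(\zeta,\xi) \] for all $\zeta,\xi\in\mathcal U_X/{\sim}$. In particular, if $\mathcal E$ is a family of unbounded subsets of $X$ and $f(\mathcal E)=\{f(R):R\in\mathcal E\}$, then $f(\mathcal E/{\sim})=f(\mathcal E)/{\sim}$ and $f(\mathrm{cl}(\mathcal E/{\sim}))=\mathrm{cl}(f(\mathcal E)/{\sim})$.
   Context: A function $f\colon X\to Y$ is a $q$-quasi-isometry if $q^{-1}d_X(x,x')-q\le d_Y(f(x),f(x'))\le q\,d_X(x,x')+q$ for all $x,x'\in X$ and every closed ball in $Y$ of radius $q$ contains an element of $f(X)$. For a metric space $(X,d)$ with a reference point $o$ and closed balls $B(x,r)$, put $\alpha R+a=\bigcup_{x\in R}B(x,\alpha d(o,x)+a)$ for $R\subseteq X$, $\alpha,a\ge0$. For unbounded $R,S\subseteq X$ let $s^+(R,S)$ be the infimum of all $\alpha\ge0$ such that $S\subseteq\alpha R+a$ for some $a\ge0$; put $s(R,S)=\max\{s^+(R,S),s^+(S,R)\}$ and $t(R,S)=\sqrt{s(R,S)}$ (independent of $o$; a subscript $X$ or $Y$ indicates the space). $\mathcal U_X$ is the family of unbounded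 subsets of $X$; $R\sim S$ means $s(R,S)=0$, which is an equivalence relation, and $t$ induces a metric on $\mathcal U_X/{\sim}$. For $\mathcal E\subseteq\mathcal U_X$, $\mathcal E/{\sim}\subseteq\mathcal U_X/{\sim}$ is the set of classes containing an element of $\mathcal E$, and $\mathrm{cl}$ denotes closure in $(\mathcal U_X/{\sim},t)$. *)

theory Defs
  imports "HOL-Analysis.Analysis"
begin

definition quasi_isometry ::
    "real \<Rightarrow> 'a set \<Rightarrow> ('a \<Rightarrow> 'a \<Rightarrow> real) \<Rightarrow> 'b set \<Rightarrow> ('b \<Rightarrow> 'b \<Rightarrow> real) \<Rightarrow> ('a \<Rightarrow> 'b) \<Rightarrow> bool"
  where "quasi_isometry q X dX Y dY f \<longleftrightarrow>
     f \<in> X \<rightarrow> Y \<and>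
     (\<forall>x\<in>X. \<forall>x'\<in>X. inverse q * dX x x' - q \<le> dY (f x) (f x') \<and>
                     dY (f x) (f x') \<le> q * dX x x' + q) \<and>
     (\<forall>y\<in>Y. Metric_space.mcball Y dY y q \<inter> f ` X \<noteq> {})"

locale pointed_metric_space = Metric_space +
  fixes base :: 'a
  assumes base_in_space: "base \<in> M"
begin

definition unbounded_sets :: "'a set set"
  where "unbounded_sets = {R. R \<subseteq> M \<and> \<not> mbounded R}"

text \<open>\<open>thicken \<alpha> R a\<close> is the set written \<open>\<alpha>R + a\<close> on paper.\<close>

definition thicken :: "real \<Rightarrow> 'a set \<Rightarrow> real \<Rightarrow> 'a set"
  where "thicken \<alpha> R a = (\<Union>x\<in>R. mcball x (\<alpha> * d base x + a))"

text \<open>The infimum is taken in the reals; for unbounded sets every \<open>\<alpha> > 1\<close> is admissible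
  (\<open>covers_gt_1\<close> below), so it is never the infimum of an empty set.\<close>

definition s_plus :: "'a set \<Rightarrow> 'a set \<Rightarrow> real"
  where "s_plus R S = Inf {\<alpha>. 0 \<le> \<alpha> \<and> (\<exists>a\<ge>0. S \<subseteq> thicken \<alpha> R a)}"

definition s :: "'a set \<Rightarrow> 'a set \<Rightarrow> real"
  where "s R S = max (s_plus R S) (s_plus S R)"

definition t :: "'a set \<Rightarrow> 'a set \<Rightarrow> real"
  where "t R S = sqrt (s R S)"

definition sim :: "('a set \<times> 'a set) set"
  where "sim = {(R, S). R \<in> unbounded_sets \<and> S \<in> unbounded_sets \<and> s R S = 0}"

definition classes :: "'a set set set"
  where "classes = unbounded_sets // sim"

text \<open>The common value of \<open>t\<close> on representatives; see \<open>t_class_eq\<close> for well-definedness.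
  The value \<open>0\<close> outside \<open>classes\<close> is a convention needed because \<open>Metric_space\<close> requires
  nonnegativity and symmetry also off the carrier.\<close>

definition t_class :: "'a set set \<Rightarrow> 'a set set \<Rightarrow> real"
  where "t_class \<zeta> \<xi> =
     (if \<zeta> \<in> classes \<and> \<xi> \<in> classes then THE r. \<exists>R\<in>\<zeta>. \<exists>S\<in>\<xi>. r = t R S else 0)"

definition class_closure :: "'a set set set \<Rightarrow> 'a set set set"
  where "class_closure A = Metric_space.mtopology classes t_class closure_of A"

text \<open>The remaining facts show that \<open>sim\<close> is an equivalence relation and that \<open>t_class\<close> is a
  metric on \<open>classes\<close>, so that \<open>class_closure\<close> is the closure in a genuine metric space.\<close>

lemma subset_thicken_iff:
  assumes "R \<subseteq> M" "S \<subseteq> M"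
  shows "S \<subseteq> thicken \<alpha> R a \<longleftrightarrow> (\<forall>y\<in>S. \<exists>x\<in>R. d x y \<le> \<alpha> * d base x + a)"
  using assms unfolding thicken_def by (auto simp: subset_iff)

definition covers :: "real \<Rightarrow> 'a set \<Rightarrow> 'a set \<Rightarrow> bool"
  where "covers \<alpha> R S \<longleftrightarrow> 0 \<le> \<alpha> \<and> (\<exists>a\<ge>0. \<forall>y\<in>S. \<exists>x\<in>R. d x y \<le> \<alpha> * d base x + a)"

lemma s_plus_eq:
  assumes "R \<subseteq> M" "S \<subseteq> M"
  shows "s_plus R S = Inf {\<alpha>. covers \<alpha> R S}"
  unfolding s_plus_def covers_def subset_thicken_iff[OF assms] ..

lemma unbounded_setsD: "R \<in> unbounded_sets \<Longrightarrow> R \<subseteq> M"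
  by (simp add: unbounded_sets_def)

lemma ex_far:
  assumes "R \<in> unbounded_sets"
  shows "\<exists>x\<in>R. K < d base x"
proof (rule ccontr)
  assume "\<not> ?thesis"
  then have "R \<subseteq> mcball base K"
    using assms base_in_space by (fastforce simp: unbounded_sets_def not_less)
  then show False
    using assms by (auto simp: unbounded_sets_def mbounded_def)
qed

lemma covers_gt_1:
  assumes R: "R \<in> unbounded_sets" and S: "S \<in> unbounded_sets" and "1 < \<alpha>"
  shows "covers \<alpha> R S"
proof -
  have "\<exists>x\<in>R. d x y \<le> \<alpha> * d base x + 0" if "y \<in> S" for y
  proof -
    obtain x where x: "x \<in> R" "d base y / (\<alpha> - 1) < d base x"
      using ex_far[OF R] by blast
    have "d base y \<le> (\<alpha> - 1) * d base x"
      using x \<open>1 < \<alpha>\<close> by (simp add: field_simps)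
    moreover have "d x y \<le> d base x + d base y"
      using triangle[of x base y] commute[of x base] that x R S base_in_space unbounded_setsD by auto
    ultimately have "d x y \<le> \<alpha> * d base x + 0"
      by (simp add: algebra_simps)
    then show ?thesis
      using x by blast
  qed
  then show ?thesis
    using \<open>1 < \<alpha>\<close> unfolding covers_def by (intro conjI exI[of _ 0]) auto
qed

lemma covers_bdd_below: "bdd_below {\<alpha>. covers \<alpha> R S}"
  by (rule bdd_belowI[of _ 0]) (auto simp: covers_def)

lemma s_plus_lower:
  assumes "R \<in> unbounded_sets" "S \<in> unbounded_sets" "covers \<alpha> R S"
  shows "s_plus R S \<le> \<alpha>"
  using assms unbounded_setsD by (auto simp: s_plus_eq intro!: cInf_lower covers_bdd_below)

lemma s_plus_nonneg:
  assumes "R \<in> unbounded_sets" "S \<in> unbounded_sets"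
  shows "0 \<le> s_plus R S"
  unfolding s_plus_eq[OF assms[THEN unbounded_setsD]]
proof (rule cInf_greatest)
  show "{\<alpha>. covers \<alpha> R S} \<noteq> {}"
    using covers_gt_1[OF assms, of 2] by auto
qed (auto simp: covers_def)

lemma s_plus_le_1:
  assumes "R \<in> unbounded_sets" "S \<in> unbounded_sets"
  shows "s_plus R S \<le> 1"
  by (rule dense_ge) (use assms s_plus_lower covers_gt_1 in blast)

lemma covers_mono:
  assumes "covers \<alpha> R S" "\<alpha> \<le> \<beta>"
  shows "covers \<beta> R S"
proof -
  have "\<alpha> * d base x + a \<le> \<beta> * d base x + a" for x a
    using assms by (simp add: mult_right_mono)
  then show ?thesis
    using assms unfolding covers_def by (meson order_trans)
qed

lemma covers_above_s_plus:
  assumes "R \<in> unbounded_sets" "S \<in> unbounded_sets" "s_plus R S < \<alpha>"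
  shows "covers \<alpha> R S"
proof -
  have "{\<alpha>. covers \<alpha> R S} \<noteq> {}"
    using covers_gt_1[OF assms(1,2), of 2] by auto
  then obtain \<beta> where "covers \<beta> R S" "\<beta> < \<alpha>"
    using assms cInf_lessD[of "{\<alpha>. covers \<alpha> R S}" \<alpha>] by (auto simp: s_plus_eq unbounded_setsD)
  then show ?thesis
    using covers_mono by simp
qed

lemma covers_trans:
  assumes "R \<subseteq> M" "S \<subseteq> M" "T \<subseteq> M" and RS: "covers \<alpha> R S" and ST: "covers \<beta> S T"
  shows "covers (\<alpha> + \<beta> + \<alpha> * \<beta>) R T"
proof -
  obtain a where a: "0 \<le> a" "\<And>y. y \<in> S \<Longrightarrow> \<exists>x\<in>R. d x y \<le> \<alpha> * d base x + a" and \<alpha>: "0 \<le> \<alpha>"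
    using RS by (auto simp: covers_def)
  obtain b where b: "0 \<le> b" "\<And>z. z \<in> T \<Longrightarrow> \<exists>y\<in>S. d y z \<le> \<beta> * d base y + b" and \<beta>: "0 \<le> \<beta>"
    using ST by (auto simp: covers_def)
  have "\<exists>x\<in>R. d x z \<le> (\<alpha> + \<beta> + \<alpha> * \<beta>) * d base x + (a + b + \<beta> * a)" if z: "z \<in> T" for z
  proof -
    obtain y where y: "y \<in> S" "d y z \<le> \<beta> * d base y + b"
      using b z by blast
    obtain x where x: "x \<in> R" "d x y \<le> \<alpha> * d base x + a"
      using a y by blast
    have M: "x \<in> M" "y \<in> M" "z \<in> M"
      using assms x y z by auto
    have "d base y \<le> d base x + (\<alpha> * d base x + a)"
      using triangle[OF base_in_space M(1,2)] x by simp
    then have "\<beta> * d base y \<le> \<beta> * (d base x + (\<alpha> * d base x + a))"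
      using \<beta> by (rule mult_left_mono)
    then have "d x z \<le> (\<alpha> + \<beta> + \<alpha> * \<beta>) * d base x + (a + b + \<beta> * a)"
      using triangle[OF M] x y by (simp add: algebra_simps)
    then show ?thesis
      using x by blast
  qed
  moreover have "0 \<le> a + b + \<beta> * a" "0 \<le> \<alpha> + \<beta> + \<alpha> * \<beta>"
    using a b \<alpha> \<beta> by auto
  ultimately show ?thesis
    unfolding covers_def by blast
qed

lemma s_plus_triangle:
  assumes "R \<in> unbounded_sets" "S \<in> unbounded_sets" "T \<in> unbounded_sets"
  shows "s_plus R T \<le> s_plus R S + s_plus S T + s_plus R S * s_plus S T"
proof (rule tendsto_lowerbound)
  let ?x = "s_plus R S" and ?y = "s_plus S T"
  have "((\<lambda>e. (?x + e) + (?y + e) + (?x + e) * (?y + e)) \<longlongrightarrow>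
      (?x + 0) + (?y + 0) + (?x + 0) * (?y + 0)) (at_right 0)"
    by (intro tendsto_intros)
  then show "((\<lambda>e. (?x + e) + (?y + e) + (?x + e) * (?y + e)) \<longlongrightarrow> ?x + ?y + ?x * ?y) (at_right 0)"
    by simp
  have "s_plus R T \<le> (?x + e) + (?y + e) + (?x + e) * (?y + e)" if "0 < e" for e
    using assms that unbounded_setsD
    by (intro s_plus_lower covers_trans[of R S T] covers_above_s_plus) auto
  then show "\<forall>\<^sub>F e in at_right 0. s_plus R T \<le> (?x + e) + (?y + e) + (?x + e) * (?y + e)"
    by (simp add: eventually_at_filter)
qed simp

lemma s_nonneg:
  assumes "R \<in> unbounded_sets" "S \<in> unbounded_sets"
  shows "0 \<le> s R S"
  using s_plus_nonneg[OF assms] by (simp add: s_def)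

lemma s_le_1:
  assumes "R \<in> unbounded_sets" "S \<in> unbounded_sets"
  shows "s R S \<le> 1"
  using s_plus_le_1 assms by (simp add: s_def)

lemma s_commute: "s R S = s S R"
  by (simp add: s_def max.commute)

lemma t_commute: "t R S = t S R"
  by (simp add: t_def s_commute)

lemma s_triangle:
  assumes "R \<in> unbounded_sets" "S \<in> unbounded_sets" "T \<in> unbounded_sets"
  shows "s R T \<le> s R S + s S T + s R S * s S T"
proof -
  have "s_plus A C \<le> s A B + s B C + s A B * s B C"
    if "A \<in> unbounded_sets" "B \<in> unbounded_sets" "C \<in> unbounded_sets" for A B C
  proof -
    have "s_plus A B * s_plus B C \<le> s A B * s B C"
      using that s_plus_nonneg s_nonneg by (intro mult_mono) (auto simp: s_def)
    moreover have "s_plus A B \<le> s A B" "s_plus B C \<le> s B C"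
      by (auto simp: s_def)
    ultimately show ?thesis
      using s_plus_triangle[OF that] by linarith
  qed
  from this[of R S T] this[of T S R] assms show ?thesis
    by (simp add: s_def[of R T] s_commute[of T S] s_commute[of S R] algebra_simps)
qed

lemma t_triangle:
  assumes "R \<in> unbounded_sets" "S \<in> unbounded_sets" "T \<in> unbounded_sets"
  shows "t R T \<le> t R S + t S T"
proof -
  let ?x = "t R S" and ?y = "t S T"
  have x: "0 \<le> ?x" "?x \<le> 1" "?x\<^sup>2 = s R S" and y: "0 \<le> ?y" "?y \<le> 1" "?y\<^sup>2 = s S T"
    using assms s_nonneg s_le_1 by (auto simp: t_def)
  have "?x * ?y \<le> 1"
    using x y by (simp add: mult_le_one)
  then have "(?x * ?y) * (?x * ?y) \<le> 2 * (?x * ?y)"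
    using x y by (intro mult_right_mono) auto
  then have "s R T \<le> (?x + ?y)\<^sup>2"
    using s_triangle[OF assms] x y by (simp add: power2_eq_square algebra_simps)
  then show ?thesis
    using x y by (simp add: t_def[of R T] real_le_lsqrt)
qed

lemma s_self:
  assumes "R \<in> unbounded_sets"
  shows "s R R = 0"
proof -
  have "covers 0 R R"
    unfolding covers_def using unbounded_setsD[OF assms]
    by (auto intro!: exI[of _ 0] simp: subset_iff) (metis mdist_zero order_refl)
  then show ?thesis
    using s_plus_lower s_plus_nonneg assms by (force simp: s_def)
qed

lemma equiv_sim: "equiv unbounded_sets sim"
proof (rule equivI)
  show "sim \<subseteq> unbounded_sets \<times> unbounded_sets"
    by (auto simp: sim_def)
  show "refl_on unbounded_sets sim"
    by (auto simp: refl_on_def sim_def s_self)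
  show "sym sim"
    by (auto simp: sym_def sim_def s_commute)
  show "trans sim"
  proof (rule transI)
    fix R S T assume "(R, S) \<in> sim" "(S, T) \<in> sim"
    then show "(R, T) \<in> sim"
      using s_triangle[of R S T] s_nonneg[of R T] by (auto simp: sim_def)
  qed
qed

lemma t_cong:
  assumes "(R, R') \<in> sim" "(S, S') \<in> sim"
  shows "t R S = t R' S'"
proof -
  have "t R R' = 0" "t S S' = 0"
    using assms by (auto simp: sim_def t_def)
  then show ?thesis
    using assms t_triangle[of R R' S] t_triangle[of R' S' S] t_triangle[of R' R S']
      t_triangle[of R S S'] t_commute[of R' R] t_commute[of S' S]
    by (auto simp: sim_def)
qed

lemma t_class_eq:
  assumes "R \<in> unbounded_sets" "S \<in> unbounded_sets"
  shows "t_class (sim `` {R}) (sim `` {S}) = t R S"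
proof -
  have "(THE r. \<exists>R'\<in>sim `` {R}. \<exists>S'\<in>sim `` {S}. r = t R' S') = t R S"
  proof (rule the_equality)
    show "\<exists>R'\<in>sim `` {R}. \<exists>S'\<in>sim `` {S}. t R S = t R' S'"
      using assms equiv_class_self[OF equiv_sim] by blast
  qed (use t_cong in auto)
  then show ?thesis
    using assms by (simp add: t_class_def classes_def quotientI)
qed

lemma classesE:
  assumes "\<zeta> \<in> classes"
  obtains R where "R \<in> unbounded_sets" "\<zeta> = sim `` {R}"
  using assms unfolding classes_def by (rule quotientE)

lemma Metric_space_classes: "Metric_space classes t_class"
proof
  show "0 \<le> t_class \<zeta> \<xi>" for \<zeta> \<xi>
  proof (cases "\<zeta> \<in> classes \<and> \<xi> \<in> classes")
    case True
    then show ?thesis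
      by (auto elim!: classesE simp: t_class_eq t_def s_nonneg)
  qed (auto simp: t_class_def)
  show "t_class \<zeta> \<xi> = t_class \<xi> \<zeta>" for \<zeta> \<xi>
  proof (cases "\<zeta> \<in> classes \<and> \<xi> \<in> classes")
    case True
    then show ?thesis
      by (auto elim!: classesE simp: t_class_eq t_commute)
  qed (auto simp: t_class_def)
  show "t_class \<zeta> \<xi> = 0 \<longleftrightarrow> \<zeta> = \<xi>" if "\<zeta> \<in> classes" "\<xi> \<in> classes" for \<zeta> \<xi>
  proof -
    obtain R S where RS: "R \<in> unbounded_sets" "\<zeta> = sim `` {R}" "S \<in> unbounded_sets" "\<xi> = sim `` {S}"
      using \<open>\<zeta> \<in> classes\<close> \<open>\<xi> \<in> classes\<close> by (metis classesE)
    then have "\<zeta> = \<xi> \<longleftrightarrow> (R, S) \<in> sim"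
      using eq_equiv_class_iff[OF equiv_sim] by simp
    also have "\<dots> \<longleftrightarrow> t R S = 0"
      using RS by (simp add: sim_def t_def)
    finally show ?thesis
      using RS by (simp add: t_class_eq)
  qed
  show "t_class \<zeta> \<upsilon> \<le> t_class \<zeta> \<xi> + t_class \<xi> \<upsilon>"
    if "\<zeta> \<in> classes" "\<xi> \<in> classes" "\<upsilon> \<in> classes" for \<zeta> \<xi> \<upsilon>
    using that by (auto elim!: classesE simp: t_class_eq t_triangle)
qed

end

end

theory Submission
  imports Defs
begin

text \<open>
  Everything in the theorem comes from one estimate: \<open>S \<subseteq> \<alpha>R + a\<close> implies
  \<open>f(S) \<subseteq> q\<^sup>2\<alpha>f(R) + a'\<close> for some \<open>a'\<close>. One factor \<open>q\<close> is lost when the distance between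
  a point of \<open>R\<close> and a point of \<open>S\<close> is transported to \<open>Y\<close>, the other one when the distance from
  the reference point, which measures the permitted radius, is expressed in \<open>Y\<close> instead of \<open>X\<close>;
  all additive errors, including the one caused by the choice of the reference points, go into \<open>a'\<close>.
  Hence \<open>s\<close> grows at most by the factor \<open>q\<^sup>2\<close> and its square root \<open>t\<close> at most by the factor \<open>q\<close>.

  The estimate uses only that distances in the two spaces bound each other up to the factor \<open>q\<close> and an
  additive constant, which is symmetric in the two spaces. It is therefore proved for
  two maps \<open>g : I \<rightarrow> X\<close> and \<open>h : I \<rightarrow> Y\<close> on a common index set. The pair \<open>(id, f)\<close> gives the
  upper bound for \<open>t\<^sub>Y\<close>, and the pair \<open>(f, id)\<close> gives the lower one, without any choice of a
  quasi-inverse of \<open>f\<close>.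

  The two bounds make the induced map \<open>F\<close> well defined and injective. It is surjective because an
  unbounded \<open>S \<subseteq> Y\<close> and the image of the set \<open>R\<close> of all points that \<open>f\<close> maps to within \<open>q\<close> of \<open>S\<close>
  are at finite Hausdorff distance, and such sets are equivalent. The statement on closures then
  holds because Lipschitz maps carry closures into closures, applied to \<open>F\<close> and to its inverse.
\<close>

section \<open>Sets at finite Hausdorff distance\<close>

context pointed_metric_space
begin

lemma unbounded_if_bounded_distance:
  assumes S: "S \<in> unbounded_sets" and T: "T \<subseteq> M"
    and near: "\<And>y. y \<in> S \<Longrightarrow> \<exists>x\<in>T. d x y \<le> a"
  shows "T \<in> unbounded_sets"
proof -
  have False if "mbounded T"
  proof -
    obtain B where B: "\<And>x x'. x \<in> T \<Longrightarrow> x' \<in> T \<Longrightarrow> d x x' \<le> B"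
      using \<open>mbounded T\<close> by (auto simp: mbounded_alt)
    have "d y y' \<le> a + B + a" if "y \<in> S" "y' \<in> S" for y y'
    proof -
      obtain x x' where x: "x \<in> T" "d x y \<le> a" and x': "x' \<in> T" "d x' y' \<le> a"
        using near \<open>y \<in> S\<close> \<open>y' \<in> S\<close> by blast
      have M: "x \<in> M" "x' \<in> M" "y \<in> M" "y' \<in> M"
        using x x' T that unbounded_setsD[OF S] by auto
      show ?thesis
        using triangle[of y x y'] triangle[of x x' y'] commute[of x y] B[of x x'] x x' M
        by auto
    qed
    then have "mbounded S"
      using unbounded_setsD[OF S] by (auto simp: mbounded_alt)
    then show False
      using S by (simp add: unbounded_sets_def)
  qed
  then show ?thesis
    using T by (auto simp: unbounded_sets_def)
qed

text \<open>Sets at finite Hausdorff distance cover each other already with \<open>\<alpha> = 0\<close>.\<close>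

lemma sim_if_finite_Hausdorff_distance:
  assumes S: "S \<in> unbounded_sets" and T: "T \<in> unbounded_sets" and "0 \<le> a"
    and TS: "\<And>y. y \<in> T \<Longrightarrow> \<exists>x\<in>S. d x y \<le> a"
    and ST: "\<And>x. x \<in> S \<Longrightarrow> \<exists>y\<in>T. d y x \<le> a"
  shows "(S, T) \<in> sim"
proof -
  have "covers 0 S T" "covers 0 T S"
    unfolding covers_def using assms by auto
  then have "s_plus S T = 0" "s_plus T S = 0"
    using s_plus_lower s_plus_nonneg S T by (meson order_antisym)+
  then show ?thesis
    using S T by (simp add: sim_def s_def)
qed

lemma t_class_eq_0_iff:
  assumes "\<zeta> \<in> classes" "\<xi> \<in> classes"
  shows "t_class \<zeta> \<xi> = 0 \<longleftrightarrow> \<zeta> = \<xi>"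
  using Metric_space.zero[OF Metric_space_classes] assms by blast

end

section \<open>Transport of coverings between coarsely bi-Lipschitz metrics\<close>

locale coarsely_bilipschitz_pair =
  X: pointed_metric_space X dX oX + Y: pointed_metric_space Y dY oY
  for X :: "'a set" and dX oX and Y :: "'b set" and dY oY +
  fixes I :: "'i set" and g :: "'i \<Rightarrow> 'a" and h :: "'i \<Rightarrow> 'b" and q c :: real
  assumes index_nonempty: "I \<noteq> {}"
    and g_in: "g \<in> I \<rightarrow> X" and h_in: "h \<in> I \<rightarrow> Y"
    and q_pos: "0 < q" and c_nonneg: "0 \<le> c"
    and dY_le: "i \<in> I \<Longrightarrow> j \<in> I \<Longrightarrow> dY (h i) (h j) \<le> q * dX (g i) (g j) + c"
    and dX_le: "i \<in> I \<Longrightarrow> j \<in> I \<Longrightarrow> dX (g i) (g j) \<le> q * dY (h i) (h j) + c"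
begin

text \<open>The symmetry of the setting in the two spaces; it turns every upper bound into a lower bound.\<close>

lemma swap: "coarsely_bilipschitz_pair Y dY oY X dX oX I h g q c"
  using index_nonempty g_in h_in q_pos c_nonneg dY_le dX_le
  by unfold_locales auto

lemma image_mbounded:
  assumes "A \<subseteq> I" and "X.mbounded (g ` A)"
  shows "Y.mbounded (h ` A)"
proof -
  obtain B where B: "\<And>i j. i \<in> A \<Longrightarrow> j \<in> A \<Longrightarrow> dX (g i) (g j) \<le> B"
    using assms(2) by (auto simp: X.mbounded_alt)
  have "dY (h i) (h j) \<le> q * B + c" if "i \<in> A" "j \<in> A" for i j
  proof -
    have "dY (h i) (h j) \<le> q * dX (g i) (g j) + c"
      using dY_le that \<open>A \<subseteq> I\<close> by blast
    also have "\<dots> \<le> q * B + c"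
      using B[OF that] q_pos by simp
    finally show ?thesis .
  qed
  then show ?thesis
    using h_in \<open>A \<subseteq> I\<close> unfolding Y.mbounded_alt by (intro conjI exI[of _ "q * B + c"]) auto
qed

lemma image_unbounded_iff:
  assumes "A \<subseteq> I"
  shows "h ` A \<in> Y.unbounded_sets \<longleftrightarrow> g ` A \<in> X.unbounded_sets"
  using image_mbounded[OF assms] coarsely_bilipschitz_pair.image_mbounded[OF swap assms]
    g_in h_in assms
  unfolding X.unbounded_sets_def Y.unbounded_sets_def by auto

text \<open>The estimate behind the theorem. An arbitrary index \<open>k\<close> compares the reference points, which
  need not correspond to each other under \<open>g\<close> and \<open>h\<close>.\<close>

lemma covers_image:
  assumes "A \<subseteq> I" "B \<subseteq> I" and cov: "X.covers \<alpha> (g ` A) (g ` B)"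
  shows "Y.covers (q\<^sup>2 * \<alpha>) (h ` A) (h ` B)"
proof -
  obtain a where \<alpha>: "0 \<le> \<alpha>" and a: "0 \<le> a"
    and near: "\<And>j. j \<in> B \<Longrightarrow> \<exists>i\<in>A. dX (g i) (g j) \<le> \<alpha> * dX oX (g i) + a"
    using cov by (auto simp: X.covers_def)
  obtain k where k: "k \<in> I"
    using index_nonempty by blast
  define e where "e = dX oX (g k) + q * dY (h k) oY + c"
  have e: "0 \<le> e"
    using q_pos c_nonneg by (simp add: e_def)
  \<comment> \<open>The permitted radius, measured from the reference point of the other space.\<close>
  have radius: "dX oX (g i) \<le> q * dY oY (h i) + e" if "i \<in> I" for i
  proof -
    have "dX oX (g i) \<le> dX oX (g k) + dX (g k) (g i)"
      using X.triangle X.base_in_space g_in k that by auto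
    moreover have "dX (g k) (g i) \<le> q * dY (h k) (h i) + c"
      using dX_le k that by blast
    moreover have "dY (h k) (h i) \<le> dY (h k) oY + dY oY (h i)"
      using Y.triangle Y.base_in_space h_in k that by auto
    then have "q * dY (h k) (h i) \<le> q * (dY (h k) oY + dY oY (h i))"
      using q_pos by simp
    ultimately show ?thesis
      by (simp add: e_def algebra_simps)
  qed
  define b where "b = q * (\<alpha> * e + a) + c"
  have "\<exists>i\<in>A. dY (h i) (h j) \<le> q\<^sup>2 * \<alpha> * dY oY (h i) + b" if j: "j \<in> B" for j
  proof -
    obtain i where i: "i \<in> A" "dX (g i) (g j) \<le> \<alpha> * dX oX (g i) + a"
      using near[OF j] by blast
    have "dY (h i) (h j) \<le> q * dX (g i) (g j) + c"
      using dY_le i j assms by blast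
    also have "\<dots> \<le> q * (\<alpha> * dX oX (g i) + a) + c"
      using i q_pos by simp
    also have "\<dots> \<le> q * (\<alpha> * (q * dY oY (h i) + e) + a) + c"
      using radius[of i] i \<open>A \<subseteq> I\<close> q_pos \<alpha> by (auto intro!: mult_left_mono)
    also have "\<dots> = q\<^sup>2 * \<alpha> * dY oY (h i) + b"
      by (simp add: b_def power2_eq_square algebra_simps)
    finally show ?thesis
      using i by blast
  qed
  moreover have "0 \<le> b" "0 \<le> q\<^sup>2 * \<alpha>"
    using q_pos \<alpha> a c_nonneg e by (simp_all add: b_def)
  ultimately show ?thesis
    unfolding Y.covers_def by blast
qed

lemma s_plus_image_le:
  assumes "A \<subseteq> I" "B \<subseteq> I" "g ` A \<in> X.unbounded_sets" "g ` B \<in> X.unbounded_sets"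
  shows "Y.s_plus (h ` A) (h ` B) \<le> q\<^sup>2 * X.s_plus (g ` A) (g ` B)"
proof -
  have "Y.s_plus (h ` A) (h ` B) / q\<^sup>2 \<le> X.s_plus (g ` A) (g ` B)"
  proof (rule dense_ge)
    fix \<alpha> assume "X.s_plus (g ` A) (g ` B) < \<alpha>"
    then have "Y.covers (q\<^sup>2 * \<alpha>) (h ` A) (h ` B)"
      using assms by (intro covers_image X.covers_above_s_plus)
    then have "Y.s_plus (h ` A) (h ` B) \<le> q\<^sup>2 * \<alpha>"
      using assms by (intro Y.s_plus_lower) (auto simp: image_unbounded_iff)
    then show "Y.s_plus (h ` A) (h ` B) / q\<^sup>2 \<le> \<alpha>"
      using q_pos by (simp add: divide_le_eq mult.commute)
  qed
  then show ?thesis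
    using q_pos by (simp add: divide_le_eq mult.commute)
qed

lemma t_image_le:
  assumes "A \<subseteq> I" "B \<subseteq> I" "g ` A \<in> X.unbounded_sets" "g ` B \<in> X.unbounded_sets"
  shows "Y.t (h ` A) (h ` B) \<le> q * X.t (g ` A) (g ` B)"
proof -
  have "q\<^sup>2 * X.s_plus (g ` A) (g ` B) \<le> q\<^sup>2 * X.s (g ` A) (g ` B)"
    "q\<^sup>2 * X.s_plus (g ` B) (g ` A) \<le> q\<^sup>2 * X.s (g ` A) (g ` B)"
    by (auto simp: X.s_def intro!: mult_left_mono)
  then have "Y.s (h ` A) (h ` B) \<le> q\<^sup>2 * X.s (g ` A) (g ` B)"
    using s_plus_image_le[of A B] s_plus_image_le[of B A] assms
    by (simp add: Y.s_def)
  then have "sqrt (Y.s (h ` A) (h ` B)) \<le> sqrt (q\<^sup>2 * X.s (g ` A) (g ` B))"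
    by simp
  then show ?thesis
    using q_pos by (simp add: X.t_def Y.t_def real_sqrt_mult)
qed

end

section \<open>Closures under bi-Lipschitz bijections\<close>

lemma Lipschitz_image_closure_subset:
  assumes "Metric_space M d" and "Metric_space N e" and "0 < K"
    and F: "F ` M \<subseteq> N" and "A \<subseteq> M"
    and lip: "\<And>x y. x \<in> M \<Longrightarrow> y \<in> M \<Longrightarrow> e (F x) (F y) \<le> K * d x y"
  shows "F ` (Metric_space.mtopology M d closure_of A)
    \<subseteq> Metric_space.mtopology N e closure_of (F ` A)"
proof -
  interpret M: Metric_space M d by fact
  interpret N: Metric_space N e by fact
  have "F x \<in> N.mtopology closure_of (F ` A)" if x: "x \<in> M.mtopology closure_of A" for x
  proof -
    have "x \<in> M" and near: "\<And>r. 0 < r \<Longrightarrow> \<exists>y\<in>A. d x y < r"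
      using x by (auto simp: M.metric_closure_of)
    have "\<exists>y\<in>A. e (F x) (F y) < r" if r: "0 < r" for r
    proof -
      obtain y where "y \<in> A" "d x y < r / K"
        using near[of "r / K"] r \<open>0 < K\<close> by auto
      moreover from this have "K * d x y < r"
        using \<open>0 < K\<close> by (simp add: less_divide_eq mult.commute)
      ultimately show ?thesis
        using lip[of x y] \<open>x \<in> M\<close> \<open>A \<subseteq> M\<close> by force
    qed
    then show ?thesis
      using \<open>x \<in> M\<close> F \<open>A \<subseteq> M\<close> by (fastforce simp: N.metric_closure_of)
  qed
  then show ?thesis
    by blast
qed

lemma bilipschitz_image_closure:
  assumes M: "Metric_space M d" and N: "Metric_space N e" and "0 < q"
    and bij: "bij_betw F M N" and "A \<subseteq> M"
    and lower: "\<And>x y. x \<in> M \<Longrightarrow> y \<in> M \<Longrightarrow> inverse q * d x y \<le> e (F x) (F y)"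
    and upper: "\<And>x y. x \<in> M \<Longrightarrow> y \<in> M \<Longrightarrow> e (F x) (F y) \<le> q * d x y"
  shows "F ` (Metric_space.mtopology M d closure_of A)
    = Metric_space.mtopology N e closure_of (F ` A)"
proof
  interpret N: Metric_space N e by fact
  show "F ` (Metric_space.mtopology M d closure_of A)
    \<subseteq> Metric_space.mtopology N e closure_of (F ` A)"
    using assms by (intro Lipschitz_image_closure_subset) (auto simp: bij_betw_def)
  let ?G = "inv_into M F"
  have G: "?G y \<in> M" "F (?G y) = y" if "y \<in> N" for y
    using bij that by (auto simp: bij_betw_def inv_into_into f_inv_into_f)
  have "?G ` (N.mtopology closure_of (F ` A))
    \<subseteq> Metric_space.mtopology M d closure_of (?G ` F ` A)"
  proof (rule Lipschitz_image_closure_subset[OF N M \<open>0 < q\<close>])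
    show "d (?G x) (?G y) \<le> q * e x y" if "x \<in> N" "y \<in> N" for x y
      using lower[of "?G x" "?G y"] G that \<open>0 < q\<close> by (simp add: field_simps)
    show "F ` A \<subseteq> N"
      using bij \<open>A \<subseteq> M\<close> by (auto simp: bij_betw_def)
  qed (use G in auto)
  moreover have "?G ` F ` A = A"
    using bij \<open>A \<subseteq> M\<close> by (simp add: bij_betw_def inv_into_image_cancel)
  moreover have "N.mtopology closure_of (F ` A) \<subseteq> N"
    using closure_of_subset_topspace[of N.mtopology] by simp
  ultimately have "?G y \<in> Metric_space.mtopology M d closure_of A \<and> F (?G y) = y"
    if "y \<in> N.mtopology closure_of (F ` A)" for y
    using G that by auto
  then show "N.mtopology closure_of (F ` A)
    \<subseteq> F ` (Metric_space.mtopology M d closure_of A)"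
    by (metis image_eqI subsetI)
qed

section \<open>The map induced by a quasi-isometry\<close>

theorem theorem3p3:
  fixes X :: "'a set" and dX :: "'a \<Rightarrow> 'a \<Rightarrow> real" and oX :: 'a
    and Y :: "'b set" and dY :: "'b \<Rightarrow> 'b \<Rightarrow> real" and oY :: 'b
    and f :: "'a \<Rightarrow> 'b" and q :: real
  assumes "pointed_metric_space X dX oX" and "pointed_metric_space Y dY oY"
    and "0 < q" and "quasi_isometry q X dX Y dY f"
  shows "(\<forall>R \<in> pointed_metric_space.unbounded_sets X dX.
            f ` R \<in> pointed_metric_space.unbounded_sets Y dY) \<and>
    (\<exists>F. (\<forall>R \<in> pointed_metric_space.unbounded_sets X dX.
             F (pointed_metric_space.sim X dX oX `` {R}) =
               pointed_metric_space.sim Y dY oY `` {f ` R}) \<and>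
         bij_betw F (pointed_metric_space.classes X dX oX) (pointed_metric_space.classes Y dY oY) \<and>
         (\<forall>\<zeta> \<in> pointed_metric_space.classes X dX oX. \<forall>\<xi> \<in> pointed_metric_space.classes X dX oX.
            inverse q * pointed_metric_space.t_class X dX oX \<zeta> \<xi>
              \<le> pointed_metric_space.t_class Y dY oY (F \<zeta>) (F \<xi>) \<and>
            pointed_metric_space.t_class Y dY oY (F \<zeta>) (F \<xi>)
              \<le> q * pointed_metric_space.t_class X dX oX \<zeta> \<xi>) \<and>
         (\<forall>\<E> \<subseteq> pointed_metric_space.unbounded_sets X dX.
            F ` (\<E> // pointed_metric_space.sim X dX oX) =
              ((`) f ` \<E>) // pointed_metric_space.sim Y dY oY \<and>
            F ` pointed_metric_space.class_closure X dX oX (\<E> // pointed_metric_space.sim X dX oX) =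
              pointed_metric_space.class_closure Y dY oY
                (((`) f ` \<E>) // pointed_metric_space.sim Y dY oY)))"
proof -
  interpret X: pointed_metric_space X dX oX by fact
  interpret Y: pointed_metric_space Y dY oY by fact
  have fX: "f \<in> X \<rightarrow> Y"
    and low: "\<And>x x'. x \<in> X \<Longrightarrow> x' \<in> X \<Longrightarrow> inverse q * dX x x' - q \<le> dY (f x) (f x')"
    and upp: "\<And>x x'. x \<in> X \<Longrightarrow> x' \<in> X \<Longrightarrow> dY (f x) (f x') \<le> q * dX x x' + q"
    and "\<And>y. y \<in> Y \<Longrightarrow> Y.mcball y q \<inter> f ` X \<noteq> {}"
    using \<open>quasi_isometry q X dX Y dY f\<close> by (simp_all add: quasi_isometry_def)
  then have dense: "\<exists>x\<in>X. dY y (f x) \<le> q" if "y \<in> Y" for y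
    using that by (fastforce simp: Y.in_mcball)
  \<comment> \<open>The upper inequality has the additive constant \<open>q\<close>; solving the lower one for \<open>dX\<close> gives \<open>q\<^sup>2\<close>.\<close>
  interpret P: coarsely_bilipschitz_pair X dX oX Y dY oY X "\<lambda>x. x" f q "q + q\<^sup>2"
  proof
    fix x x' assume x: "x \<in> X" "x' \<in> X"
    show "dY (f x) (f x') \<le> q * dX x x' + (q + q\<^sup>2)"
      using upp[OF x] zero_le_power2[of q] by linarith
    have "dX x x' \<le> q * dY (f x) (f x') + q\<^sup>2"
      using low[OF x] \<open>0 < q\<close> by (simp add: field_simps power2_eq_square)
    then show "dX x x' \<le> q * dY (f x) (f x') + (q + q\<^sup>2)"
      using \<open>0 < q\<close> by linarith
  qed (use fX \<open>0 < q\<close> X.base_in_space in auto)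
  interpret Q: coarsely_bilipschitz_pair Y dY oY X dX oX X f "\<lambda>x. x" q "q + q\<^sup>2"
    by (rule P.swap)

  have unb_iff: "f ` R \<in> Y.unbounded_sets \<longleftrightarrow> R \<in> X.unbounded_sets" if "R \<subseteq> X" for R
    using P.image_unbounded_iff[OF that] by simp
  have unb: "f ` R \<in> Y.unbounded_sets" if "R \<in> X.unbounded_sets" for R
    using unb_iff that X.unbounded_setsD by blast
  have upper: "Y.t (f ` R) (f ` S) \<le> q * X.t R S"
    if "R \<in> X.unbounded_sets" "S \<in> X.unbounded_sets" for R S
    using P.t_image_le[of R S] that X.unbounded_setsD by simp
  have lower: "inverse q * X.t R S \<le> Y.t (f ` R) (f ` S)"
    if "R \<in> X.unbounded_sets" "S \<in> X.unbounded_sets" for R S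
    using Q.t_image_le[of R S] that X.unbounded_setsD unb \<open>0 < q\<close> by (simp add: field_simps)

  define F where "F \<zeta> = (\<Union>R\<in>\<zeta>. Y.sim `` {f ` R})" for \<zeta>
  have "(\<lambda>R. Y.sim `` {f ` R}) respects X.sim"
  proof (rule congruentI)
    fix R S assume "(R, S) \<in> X.sim"
    then have RS: "R \<in> X.unbounded_sets" "S \<in> X.unbounded_sets" "X.t R S = 0"
      by (auto simp: X.sim_def X.t_def)
    then have "Y.s (f ` R) (f ` S) = 0"
      using upper[of R S] Y.s_nonneg[of "f ` R" "f ` S"] unb by (simp add: Y.t_def)
    then have "(f ` R, f ` S) \<in> Y.sim"
      using RS unb by (simp add: Y.sim_def)
    then show "Y.sim `` {f ` R} = Y.sim `` {f ` S}"
      by (rule equiv_class_eq[OF Y.equiv_sim])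
  qed
  then have F: "F (X.sim `` {R}) = Y.sim `` {f ` R}" if "R \<in> X.unbounded_sets" for R
    unfolding F_def using that by (rule UN_equiv_class[OF X.equiv_sim])

  have bilip: "inverse q * X.t_class \<zeta> \<xi> \<le> Y.t_class (F \<zeta>) (F \<xi>) \<and>
      Y.t_class (F \<zeta>) (F \<xi>) \<le> q * X.t_class \<zeta> \<xi>"
    if \<zeta>: "\<zeta> \<in> X.classes" and \<xi>: "\<xi> \<in> X.classes" for \<zeta> \<xi>
  proof -
    obtain R S where "R \<in> X.unbounded_sets" "\<zeta> = X.sim `` {R}" "S \<in> X.unbounded_sets" "\<xi> = X.sim `` {S}"
      using \<zeta> \<xi> by (metis X.classesE)
    then show ?thesis
      using upper[of R S] lower[of R S] unb by (simp add: F X.t_class_eq Y.t_class_eq)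
  qed

  have F_in: "F \<zeta> \<in> Y.classes" if "\<zeta> \<in> X.classes" for \<zeta>
    using that unb by (auto elim!: X.classesE simp: F Y.classes_def quotientI)

  have bij: "bij_betw F X.classes Y.classes"
  proof (rule bij_betw_imageI)
    show "inj_on F X.classes"
    proof (rule inj_onI)
      fix \<zeta> \<xi> assume \<zeta>\<xi>: "\<zeta> \<in> X.classes" "\<xi> \<in> X.classes" "F \<zeta> = F \<xi>"
      then have "Y.t_class (F \<zeta>) (F \<xi>) = 0"
        using Y.t_class_eq_0_iff F_in by auto
      then have "X.t_class \<zeta> \<xi> \<le> 0"
        using bilip[of \<zeta> \<xi>] \<zeta>\<xi> \<open>0 < q\<close> by (simp add: mult_le_0_iff)
      then have "X.t_class \<zeta> \<xi> = 0"
        using Metric_space.nonneg[OF X.Metric_space_classes, of \<zeta> \<xi>] by linarith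
      then show "\<zeta> = \<xi>"
        using X.t_class_eq_0_iff \<zeta>\<xi> by blast
    qed
    have "\<eta> \<in> F ` X.classes" if \<eta>: "\<eta> \<in> Y.classes" for \<eta>
    proof -
      obtain S where S: "S \<in> Y.unbounded_sets" "\<eta> = Y.sim `` {S}"
        using \<eta> by (rule Y.classesE)
      define R where "R = {x \<in> X. \<exists>y\<in>S. dY y (f x) \<le> q}"
      have SY: "S \<subseteq> Y"
        using S Y.unbounded_setsD by blast
      have near: "\<exists>z\<in>f ` R. dY z y \<le> q" if y: "y \<in> S" for y
      proof -
        obtain x where x: "x \<in> X" "dY y (f x) \<le> q"
          using dense SY y by blast
        then have "x \<in> R"
          using y by (auto simp: R_def)
        then show ?thesis
          using x Y.commute[of y "f x"] by auto
      qed
      have R: "R \<in> X.unbounded_sets"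
        using Y.unbounded_if_bounded_distance[OF S(1) _ near] unb_iff[of R] fX
        by (auto simp: R_def)
      have "(f ` R, S) \<in> Y.sim"
        using near unb[OF R] S \<open>0 < q\<close>
        by (intro Y.sim_if_finite_Hausdorff_distance[of _ _ q]) (auto simp: R_def)
      then have "\<eta> = F (X.sim `` {R})"
        using S F[OF R] equiv_class_eq[OF Y.equiv_sim] by metis
      then show ?thesis
        using R by (auto simp: X.classes_def quotientI)
    qed
    then show "F ` X.classes = Y.classes"
      using F_in by blast
  qed

  have family: "F ` (\<E> // X.sim) = ((`) f ` \<E>) // Y.sim" if "\<E> \<subseteq> X.unbounded_sets" for \<E>
  proof -
    have "F ` (\<E> // X.sim) = (\<Union>R\<in>\<E>. {F (X.sim `` {R})})"
      by (auto simp: quotient_def)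
    also have "\<dots> = (\<Union>R\<in>\<E>. {Y.sim `` {f ` R}})"
      using F that by (intro SUP_cong) auto
    finally show ?thesis
      by (auto simp: quotient_def)
  qed

  have closure: "F ` X.class_closure (\<E> // X.sim) = Y.class_closure (((`) f ` \<E>) // Y.sim)"
    if \<E>: "\<E> \<subseteq> X.unbounded_sets" for \<E>
  proof -
    have "\<E> // X.sim \<subseteq> X.classes"
      using \<E> by (auto simp: X.classes_def quotient_def)
    then show ?thesis
      unfolding X.class_closure_def Y.class_closure_def family[OF \<E>, symmetric]
      using bilip
      by (intro bilipschitz_image_closure[OF X.Metric_space_classes Y.Metric_space_classes \<open>0 < q\<close> bij])
        auto
  qed

  show ?thesis
    using unb F bij bilip family closure by (intro conjI exI[of _ F] ballI allI impI) simp_all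
qed

end
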